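(* A Minkowski plane $(M,\|\cdot\|)$ is Euclidean if and only if for any $\mathcal{C}$-orthocentric system $\{p_1,p_2,p_3,p_4\}$ in $M$ the relation $(p_i-p_j)\perp_B(p_k-p_l)$ holds whenever $\{i,j,k,l\}=\{1,2,3,4\}$.
   Context: A Minkowski plane is a real two-dimensional normed linear space; it is Euclidean if its norm is induced by an inner product. Birkhoff orthogonality: $x\perp_B y$ means $\|x+ty\|\ge\|x\|$ for all $t\in\mathbb{R}$. $S_p(w)=2p-w$ is the symmetry with center $p$. For points $a,b,c\in M$, the set of circumcenters is $\mathcal{C}(\triangle abc)=\{x\in M:\|x-a\|=\|x-b\|=\|x-c\|\}$. $\mathcal{C}$-orthocenter: given points $a,b,c\in M$ and $o\in\mathcal{C}(\triangle abc)$, put $q=\frac{a+b+c-o}{2}$, which is the point of symmetry between $\triangle abc$ and the triangle whose vertices are the images of $o$ under the symmetries at the midpoints of the sides $[b,c],[a,c],[a,b]$. The $\mathcal{C}$-orthocenter of $\triangle abc$ associated with $o$ is $S_q(o)=a+b+c-2o$. $\mathcal{C}$-orthocentric system: four points $p_1,p_2,p_3,p_4\in M$ form a $\mathcal{C}$-orthocentric system $\{p_1,p_2,p_3,p_4\}$ if for some labeling $\{i,j,k,l\}=\{1,2,3,4\}$ there is a circumcenter $x_i\in\mathcal{C}(\triangle p_jp_kp_l)$ such that $p_i$ is the $\mathcal{C}$-orthocenter of $\triangle p_jp_kp_l$ associated with $x_i$. *)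

theory Defs
  imports "HOL-Analysis.Analysis"
begin

definition inner_product_on_type :: "('a::real_vector \<Rightarrow> 'a \<Rightarrow> real) \<Rightarrow> bool" where
  "inner_product_on_type ip \<longleftrightarrow>
     bilinear ip \<and> (\<forall>x y. ip x y = ip y x) \<and> (\<forall>x. x \<noteq> 0 \<longrightarrow> ip x x > 0)"

definition induced_by_inner_product :: "('a::real_vector \<Rightarrow> real) \<Rightarrow> bool" where
  "induced_by_inner_product N \<longleftrightarrow> (\<exists>ip. inner_product_on_type ip \<and> (\<forall>x. N x = sqrt (ip x x)))"

definition birkhoff_orthogonal :: "'a::real_normed_vector \<Rightarrow> 'a \<Rightarrow> bool"
    (infix "\<bottom>\<^sub>B" 50) where
  "x \<bottom>\<^sub>B y \<longleftrightarrow> (\<forall>t::real. norm (x + t *\<^sub>R y) \<ge> norm x)"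

definition point_symmetry :: "'a::real_vector \<Rightarrow> 'a \<Rightarrow> 'a" where
  "point_symmetry p w = 2 *\<^sub>R p - w"

definition circumcenters :: "'a::real_normed_vector \<Rightarrow> 'a \<Rightarrow> 'a \<Rightarrow> 'a set" where
  "circumcenters a b c = {x. norm (x - a) = norm (x - b) \<and> norm (x - b) = norm (x - c)}"

definition symmetry_center :: "'a::real_vector \<Rightarrow> 'a \<Rightarrow> 'a \<Rightarrow> 'a \<Rightarrow> 'a" where
  "symmetry_center a b c z = (1/2) *\<^sub>R (a + b + c - z)"

text \<open>Only meaningful when \<open>z\<close> is a circumcenter of \<open>a\<close>, \<open>b\<close>, \<open>c\<close>; the definition of
  \<open>C_orthocentric_system\<close> imposes this separately.\<close>

definition C_orthocenter :: "'a::real_vector \<Rightarrow> 'a \<Rightarrow> 'a \<Rightarrow> 'a \<Rightarrow> 'a" where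
  "C_orthocenter a b c z = point_symmetry (symmetry_center a b c z) z"

lemma C_orthocenter_eq: "C_orthocenter a b c z = a + b + c - 2 *\<^sub>R z"
  by (simp add: C_orthocenter_def symmetry_center_def point_symmetry_def scaleR_2)

lemma symmetry_center_swaps:
  fixes a b c z :: "'a::real_vector"
  defines "q \<equiv> symmetry_center a b c z"
  shows "point_symmetry q a = point_symmetry (midpoint b c) z"
    and "point_symmetry q b = point_symmetry (midpoint a c) z"
    and "point_symmetry q c = point_symmetry (midpoint a b) z"
  by (simp_all add: q_def symmetry_center_def point_symmetry_def midpoint_def)

text \<open>The four points are \<open>p 1\<close>, \<open>p 2\<close>, \<open>p 3\<close>, \<open>p 4\<close>; other values of \<open>p\<close> play no role.
  The equation \<open>{i, j, k, l} = {1, 2, 3, 4}\<close> forces the four indices to be distinct.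
  The points themselves may coincide: in a Euclidean right triangle, for instance, the
  orthocenter is a vertex.\<close>

definition C_orthocentric_system :: "(nat \<Rightarrow> 'a::real_normed_vector) \<Rightarrow> bool" where
  "C_orthocentric_system p \<longleftrightarrow>
     (\<exists>i j k l. {i, j, k, l} = {1, 2, 3, 4} \<and>
        (\<exists>x \<in> circumcenters (p j) (p k) (p l). p i = C_orthocenter (p j) (p k) (p l) x))"

end

(* An orthocentric system with circumcenter 0 and vertices u, u, v has orthocenter 2u + v, so the
   condition says that u + v is Birkhoff orthogonal to u - v whenever u and v have equal norm.
   This forces strict convexity, whence the linear reflection fixing x and negating y is an
   isometry whenever x is Birkhoff orthogonal to y. These reflections act transitively on the
   unit circle (u + v, u - v gives one swapping u and v). Among the quadratic forms below the
   squared norm, one of maximal determinant is compatible with all of them, hence is constant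
   on the unit circle. *)
theory Submission
  imports Defs
begin

section \<open>Birkhoff orthogonality and the Euclidean case\<close>

lemma birkhoff_scaleR:
  assumes "x \<bottom>\<^sub>B y"
  shows "c *\<^sub>R x \<bottom>\<^sub>B d *\<^sub>R y"
proof (cases "c = 0")
  case False
  have "norm (c *\<^sub>R x) \<le> norm (c *\<^sub>R x + t *\<^sub>R d *\<^sub>R y)" for t
  proof -
    have "c *\<^sub>R x + t *\<^sub>R d *\<^sub>R y = c *\<^sub>R (x + (t * d / c) *\<^sub>R y)"
      using False by (simp add: scaleR_add_right)
    moreover have "norm x \<le> norm (x + (t * d / c) *\<^sub>R y)"
      using assms by (simp add: birkhoff_orthogonal_def)
    ultimately show ?thesis by (simp add: mult_left_mono)
  qed
  then show ?thesis by (simp add: birkhoff_orthogonal_def)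
qed (simp add: birkhoff_orthogonal_def)

lemma birkhoff_norm_ge:
  assumes "x \<bottom>\<^sub>B y"
  shows "norm (a *\<^sub>R x + b *\<^sub>R y) \<ge> \<bar>a\<bar> * norm x"
  using birkhoff_scaleR[OF assms, of a b] unfolding birkhoff_orthogonal_def
  by (metis norm_scaleR scaleR_one)

lemma inner_product_zero_imp_birkhoff:
  fixes ip :: "'a::real_normed_vector \<Rightarrow> 'a \<Rightarrow> real"
  assumes ip: "inner_product_on_type ip" and N: "\<And>x. norm x = sqrt (ip x x)"
    and "ip x y = 0"
  shows "x \<bottom>\<^sub>B y"
proof -
  have bl: "bilinear ip" and sym: "ip y x = ip x y"
    using ip by (auto simp: inner_product_on_type_def)
  have "ip y y \<ge> 0"
    using N[of y] by (metis norm_ge_zero real_sqrt_ge_0_iff)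
  moreover have "ip (x + t *\<^sub>R y) (x + t *\<^sub>R y) = ip x x + t * t * ip y y" for t
    using assms(3) sym
    by (simp add: bilinear_ladd[OF bl] bilinear_radd[OF bl] bilinear_lmul[OF bl] bilinear_rmul[OF bl])
  ultimately show ?thesis
    by (simp add: birkhoff_orthogonal_def N)
qed

text \<open>Relative to the circumcenter the triangle has vertices \<open>u\<close>,
  \<open>v\<close>, \<open>w\<close> of equal norm and orthocenter \<open>u + v + w\<close>.
  Opposite differences are then a sum and a difference of the same two vectors, such as
  \<open>v + w\<close> and \<open>v - w\<close>, whose product is a difference of equal squared
  norms.\<close>

lemma inner_product_orthocentric:
  fixes p :: "nat \<Rightarrow> 'a::real_normed_vector"
  assumes ip: "inner_product_on_type ip" and N: "\<And>x. norm x = sqrt (ip x x)"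
    and "C_orthocentric_system p" and abcd: "{a, b, c, d} = {1, 2, 3, 4}"
  shows "ip (p a - p b) (p c - p d) = 0"
proof -
  have bl: "bilinear ip" and sym: "\<And>x y. ip x y = ip y x"
    using ip by (auto simp: inner_product_on_type_def)
  note bs = bilinear_ladd[OF bl] bilinear_radd[OF bl] bilinear_lsub[OF bl] bilinear_rsub[OF bl]
  obtain i j k l x where ijkl: "{i, j, k, l} = {1, 2, 3, 4}"
    and x: "x \<in> circumcenters (p j) (p k) (p l)"
    and pi: "p i = p j + p k + p l - 2 *\<^sub>R x"
    using assms(3) by (auto simp: C_orthocentric_system_def C_orthocenter_eq)
  define u v w where "u = p j - x" and "v = p k - x" and "w = p l - x"
  have "norm u = norm v" "norm v = norm w"
    using x by (auto simp: circumcenters_def u_def v_def w_def norm_minus_commute)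
  then have eq: "ip u u = ip v v" "ip v v = ip w w"
    by (simp_all add: N)
  have p: "p i = x + (u + v + w)" "p j = x + u" "p k = x + v" "p l = x + w"
    by (simp_all add: pi u_def v_def w_def scaleR_2)
  have d: "p i - p j = v + w" "p i - p k = u + w" "p i - p l = u + v"
    "p k - p l = v - w" "p j - p l = u - w" "p j - p k = u - v"
    by (simp_all add: p algebra_simps)
  have o: "ip (p i - p j) (p k - p l) = 0" "ip (p i - p k) (p j - p l) = 0"
    "ip (p i - p l) (p j - p k) = 0"
    using eq by (simp_all add: d bs sym[of v u] sym[of w u] sym[of w v])
  \<comment> \<open>There are three ways to split the four points into two pairs. Flipping either
    difference and exchanging the two pairs turns these three relations into all 24
    labelings.\<close>
  have perm: "ip (p c - p d) (p a - p b) = 0" "ip (p b - p a) (p c - p d) = 0"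
    "ip (p a - p b) (p d - p c) = 0" if "ip (p a - p b) (p c - p d) = 0" for a b c d
    using that bilinear_lneg[OF bl, of "p a - p b"] bilinear_rneg[OF bl, of _ "p c - p d"]
      sym[of "p c - p d" "p a - p b"] by simp_all
  note o1 = o o[THEN perm(2)]
  note o2 = o1 o1[THEN perm(3)]
  note o3 = o2 o2[THEN perm(1)]
  have "card {a, b, c, d} = 4" unfolding abcd by simp
  then have dist: "distinct [a, b, c, d]"
    using card_distinct[of "[a, b, c, d]"] by simp
  have "{a, b, c, d} = {i, j, k, l}" using abcd ijkl by simp
  then have "a \<in> {i, j, k, l}" "b \<in> {i, j, k, l}" "c \<in> {i, j, k, l}" "d \<in> {i, j, k, l}" by auto
  then show ?thesis
    using dist by (elim insertE emptyE) (simp_all add: o3)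
qed

section \<open>From orthocentric systems to linear reflections\<close>

lemma orthocentric_imp_sum_birkhoff_diff:
  fixes u v :: "'a::real_normed_vector"
  assumes "\<forall>p :: nat \<Rightarrow> 'a. C_orthocentric_system p \<longrightarrow>
       (\<forall>i j k l. {i, j, k, l} = {1, 2, 3, 4} \<longrightarrow> (p i - p j) \<bottom>\<^sub>B (p k - p l))"
    and "norm u = norm v"
  shows "(u + v) \<bottom>\<^sub>B (u - v)"
proof -
  \<comment> \<open>The default value makes \<open>p 2\<close> and \<open>p 3\<close> both equal to
    \<open>u\<close>, so that \<open>p 1 - p 2\<close> is \<open>u + v\<close> and
    \<open>p 3 - p 4\<close> is \<open>u - v\<close>.\<close>
  define p :: "nat \<Rightarrow> 'a" where "p n = (if n = 1 then u + u + v else if n = 4 then v else u)" for n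
  have "0 \<in> circumcenters (p 2) (p 3) (p 4)" "p 1 = C_orthocenter (p 2) (p 3) (p 4) 0"
    using assms(2) by (simp_all add: circumcenters_def C_orthocenter_eq p_def)
  then have "C_orthocentric_system p"
    unfolding C_orthocentric_system_def by blast
  then have "(p 1 - p 2) \<bottom>\<^sub>B (p 3 - p 4)"
    using assms(1) by blast
  then show ?thesis by (simp add: p_def)
qed

text \<open>If the unit sphere contains a segment from \<open>b\<close>, prolong the segment beyond its last point
  on the sphere and project back to get \<open>u\<close>. Then \<open>b + u\<close> points into the relative interior
  of the flat piece, which is Birkhoff orthogonal to its own direction only, whereas
  \<open>b - u\<close> has a different direction.\<close>

lemma birkhoff_foot_unique:
  fixes x y :: "'a::real_normed_vector"
  assumes H: "\<And>u v::'a. norm u = norm v \<Longrightarrow> (u + v) \<bottom>\<^sub>B (u - v)"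
    and xy: "x \<bottom>\<^sub>B y" "(x + t *\<^sub>R y) \<bottom>\<^sub>B y" and y: "y \<noteq> 0" and t: "t \<ge> 0"
  shows "t = 0"
proof (rule ccontr)
  assume "t \<noteq> 0"
  with t have t: "t > 0" by simp
  define r where "r = norm x"
  have ge: "norm (x + s *\<^sub>R y) \<ge> r" for s
    using xy(1) by (simp add: birkhoff_orthogonal_def r_def)
  have "norm (x + t *\<^sub>R y) \<le> norm (x + t *\<^sub>R y + (-t) *\<^sub>R y)"
    using xy(2) unfolding birkhoff_orthogonal_def by blast
  then have tr: "norm (x + t *\<^sub>R y) = r" using ge[of t] by (simp add: r_def)
  have r: "r > 0"
  proof (rule ccontr)
    assume "\<not> r > 0"
    then have "r = 0" using r_def by (metis norm_ge_zero not_less order_antisym_conv)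
    then have "x = 0" "x + t *\<^sub>R y = 0" using tr r_def by simp_all
    then show False using t y by simp
  qed
  \<comment> \<open>The line through \<open>x\<close> with direction \<open>y\<close> supports the
    ball of radius \<open>r\<close> about 0, and \<open>T\<close> parametrizes the points where they
    touch. Its supremum \<sigma> is the far end of the flat piece.\<close>
  define T where "T = {s. norm (x + s *\<^sub>R y) = r}"
  have "closed T" unfolding T_def
    by (intro closed_Collect_eq continuous_intros)
  have "s \<le> 2 * r / norm y" if "s \<in> T" for s
  proof -
    have "norm (s *\<^sub>R y) \<le> norm (x + s *\<^sub>R y) + norm x"
      by (metis add_diff_cancel_left' norm_triangle_ineq4)
    then have "\<bar>s\<bar> * norm y \<le> 2 * r" using that by (simp add: T_def r_def)
    then have "\<bar>s\<bar> \<le> 2 * r / norm y" using y by (simp add: field_simps)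
    then show ?thesis by simp
  qed
  then have bdd: "bdd_above T" by (rule bdd_aboveI)
  have "t \<in> T" using tr by (simp add: T_def)
  define \<sigma> where "\<sigma> = Sup T"
  have "\<sigma> \<in> T" unfolding \<sigma>_def
    using \<open>closed T\<close> bdd \<open>t \<in> T\<close> by (intro closed_contains_Sup) auto
  have \<sigma>: "\<sigma> > 0" using cSup_upper[OF \<open>t \<in> T\<close> bdd] t by (simp add: \<sigma>_def)
  have flat: "norm (x + s *\<^sub>R y) = r" if "0 \<le> s" "s \<le> \<sigma>" for s
  proof -
    define c where "c = s / \<sigma>"
    have c: "0 \<le> c" "c \<le> 1" "s = c * \<sigma>" using that \<sigma> by (auto simp: c_def)
    have "x + s *\<^sub>R y = (1 - c) *\<^sub>R x + c *\<^sub>R (x + \<sigma> *\<^sub>R y)"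
      by (simp add: c algebra_simps)
    then have "norm (x + s *\<^sub>R y) \<le> norm ((1 - c) *\<^sub>R x) + norm (c *\<^sub>R (x + \<sigma> *\<^sub>R y))"
      by (metis norm_triangle_ineq)
    also have "\<dots> = (1 - c) * r + c * r"
      using c \<open>\<sigma> \<in> T\<close> by (simp add: T_def r_def)
    finally show ?thesis using ge[of s] by (simp add: algebra_simps)
  qed
  \<comment> \<open>Any parameter beyond \<sigma> would do. The point there has norm
    \<open>N * r\<close> with \<open>N > 1\<close>, and \<open>u\<close> is its radial projection
    onto the sphere of radius \<open>r\<close>.\<close>
  have "2 * \<sigma> \<notin> T" using cSup_upper[OF _ bdd] \<sigma> by (force simp: \<sigma>_def)
  define N where "N = norm (x + (2 * \<sigma>) *\<^sub>R y) / r"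
  have N: "N > 1" using \<open>2 * \<sigma> \<notin> T\<close> ge[of "2 * \<sigma>"] r by (simp add: N_def T_def)
  define u where "u = (1 / N) *\<^sub>R (x + (2 * \<sigma>) *\<^sub>R y)"
  have "norm (x + (2 * \<sigma>) *\<^sub>R y) = N * r" using r by (simp add: N_def)
  then have "norm u = norm x" using N by (simp add: u_def r_def)
  then have o: "(u + x) \<bottom>\<^sub>B (u - x)" by (rule H)
  \<comment> \<open>The ray through \<open>u + x\<close> meets the supporting line at parameter
    \<kappa>, which lies strictly between 0 and \<sigma> because \<open>N > 1\<close>.\<close>
  define \<kappa> where "\<kappa> = 2 * \<sigma> / (N + 1)"
  have ux: "(N / (N + 1)) *\<^sub>R (u + x) = x + \<kappa> *\<^sub>R y"
  proof -
    have "(N / (N + 1)) *\<^sub>R (u + x)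
        = (1 / (N + 1)) *\<^sub>R (x + (2 * \<sigma>) *\<^sub>R y) + (N / (N + 1)) *\<^sub>R x"
      using N by (simp add: u_def scaleR_add_right[of _ _ x])
    also have "\<dots> = (1 / (N + 1) + N / (N + 1)) *\<^sub>R x + \<kappa> *\<^sub>R y"
      by (simp only: scaleR_add_left scaleR_add_right) (simp add: \<kappa>_def)
    also have "1 / (N + 1) + N / (N + 1) = 1" using N by (simp add: add_divide_distrib[symmetric])
    finally show ?thesis by simp
  qed
  \<comment> \<open>A step of length \<tau> from \<open>x + \<kappa> *\<^sub>R y\<close> along
    \<open>u - x\<close> ends at \<mu> times the point of the line with parameter
    \<open>\<nu> / \<mu>\<close>. The choice of \<tau> is small enough to keep that parameter at
    most \<sigma>, so the norm drops to \<open>\<mu> * r < r\<close>, against Birkhoff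
    orthogonality.\<close>
  define \<tau> where "\<tau> = (N - 1) / (2 * (N + 1))"
  define \<mu> where "\<mu> = 1 - \<tau> * (1 - 1 / N)"
  define \<nu> where "\<nu> = \<kappa> + 2 * \<tau> * \<sigma> / N"
  have \<tau>: "\<tau> > 0" "\<tau> < 1" using N by (simp_all add: \<tau>_def field_simps)
  have "\<tau> * (1 - 1 / N) < 1 * 1"
    using \<tau> N by (intro mult_strict_mono) auto
  then have \<mu>: "\<mu> > 0" "\<mu> < 1" using \<tau> N by (simp_all add: \<mu>_def)
  have \<nu>0: "\<nu> \<ge> 0" using \<sigma> \<tau> N by (simp add: \<nu>_def \<kappa>_def)
  have frac: "(N - 1) / (N + 1) = 1 - 2 / (N + 1)" using N by (simp add: field_simps)
  have gap: "\<sigma> * \<mu> - \<nu> = \<sigma> * ((N - 1) / (N + 1) - \<tau> * (1 + 1 / N))"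
    unfolding frac by (simp add: \<mu>_def \<nu>_def \<kappa>_def algebra_simps)
  have "\<tau> * (1 + 1 / N) \<le> \<tau> * 2" using \<tau> N by (intro mult_left_mono) auto
  also have "\<tau> * 2 = (N - 1) / (N + 1)" using N by (simp add: \<tau>_def field_simps)
  finally have "\<sigma> * \<mu> - \<nu> \<ge> 0" unfolding gap using \<sigma> by simp
  then have "\<nu> \<le> \<mu> * \<sigma>" by (simp add: mult.commute)
  then have "norm (x + (\<nu> / \<mu>) *\<^sub>R y) = r"
    using \<mu> \<nu>0 by (intro flat) (simp_all add: field_simps)
  moreover have "x + \<kappa> *\<^sub>R y + \<tau> *\<^sub>R (u - x) = \<mu> *\<^sub>R (x + (\<nu> / \<mu>) *\<^sub>R y)"
  proof -
    have "x + \<kappa> *\<^sub>R y + \<tau> *\<^sub>R (u - x)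
        = (1 - \<tau> * (1 - 1 / N)) *\<^sub>R x + (\<kappa> + 2 * \<tau> * \<sigma> / N) *\<^sub>R y"
      by (simp add: u_def algebra_simps)
    then show ?thesis using \<mu> by (simp add: \<mu>_def[symmetric] \<nu>_def[symmetric] scaleR_add_right)
  qed
  ultimately have "norm (x + \<kappa> *\<^sub>R y + \<tau> *\<^sub>R (u - x)) = \<mu> * r"
    using \<mu> by simp
  moreover have "(x + \<kappa> *\<^sub>R y) \<bottom>\<^sub>B (u - x)"
    using birkhoff_scaleR[OF o, of "N / (N + 1)" 1] by (simp add: ux)
  ultimately have "norm (x + \<kappa> *\<^sub>R y) \<le> \<mu> * r"
    unfolding birkhoff_orthogonal_def by metis
  moreover have "\<mu> * r < r" using \<mu> r by simp
  ultimately show False using ge[of \<kappa>] by simp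
qed

text \<open>Some two points of the line through \<open>x\<close> along \<open>y\<close>, at distance
  parameter \<open>2 * s\<close>, have equal norms. By \<open>H\<close> their midpoint is Birkhoff
  orthogonal to \<open>y\<close>, and uniqueness of such a point on the line makes it
  \<open>x\<close> itself.\<close>

lemma birkhoff_imp_reflection:
  fixes x y :: "'a::real_normed_vector"
  assumes H: "\<And>u v::'a. norm u = norm v \<Longrightarrow> (u + v) \<bottom>\<^sub>B (u - v)"
    and xy: "x \<bottom>\<^sub>B y"
  shows "norm (a *\<^sub>R x + b *\<^sub>R y) = norm (a *\<^sub>R x - b *\<^sub>R y)"
proof -
  have pos: "norm (x + s *\<^sub>R y) = norm (x - s *\<^sub>R y)" if s: "s > 0" and y: "y \<noteq> 0" for s
  proof -
    \<comment> \<open>At \<open>- s\<close> and \<open>s\<close> one of the two points compared is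
      \<open>x\<close>, which has least norm on the line; this gives the signs for the intermediate
      value theorem.\<close>
    define g where "g t = norm (x + t *\<^sub>R y + s *\<^sub>R y) - norm (x + t *\<^sub>R y - s *\<^sub>R y)" for t
    have "norm x \<le> norm (x + (2 * s) *\<^sub>R y)" "norm x \<le> norm (x + (- 2 * s) *\<^sub>R y)"
      using xy by (simp_all only: birkhoff_orthogonal_def)
    moreover have "s *\<^sub>R y + s *\<^sub>R y = (2 * s) *\<^sub>R y"
      by (metis mult_2 scaleR_left_distrib)
    ultimately have "g (- s) \<le> 0" "0 \<le> g s"
      by (simp_all add: g_def add.assoc diff_diff_eq)
    moreover have "continuous_on {- s..s} g"
      unfolding g_def by (intro continuous_intros)
    ultimately obtain t where "g t = 0"
      using IVT'[of g "- s" 0 s] s by auto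
    define z where "z = x + t *\<^sub>R y"
    have "norm (z + s *\<^sub>R y) = norm (z - s *\<^sub>R y)"
      using \<open>g t = 0\<close> by (simp add: g_def z_def)
    then have "(2 *\<^sub>R z) \<bottom>\<^sub>B ((2 * s) *\<^sub>R y)"
      using H[of "z + s *\<^sub>R y" "z - s *\<^sub>R y"] \<open>s *\<^sub>R y + s *\<^sub>R y = _\<close> by (simp add: scaleR_2)
    then have zy: "z \<bottom>\<^sub>B y"
      using birkhoff_scaleR[of "2 *\<^sub>R z" "(2 * s) *\<^sub>R y" "1/2" "1 / (2 * s)"] s by simp
    have "t = 0"
    proof (cases "t \<ge> 0")
      case True
      then show ?thesis using birkhoff_foot_unique[OF H xy _ y] zy by (simp add: z_def)
    next
      case False
      \<comment> \<open>For negative \<open>t\<close> the roles of \<open>x\<close> and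
        \<open>z\<close> are exchanged, since \<open>birkhoff_foot_unique\<close> takes a
        nonnegative parameter.\<close>
      have "(z + (- t) *\<^sub>R y) \<bottom>\<^sub>B y" using xy by (simp add: z_def)
      from birkhoff_foot_unique[OF H zy this y] False show ?thesis by simp
    qed
    then show ?thesis using \<open>g t = 0\<close> by (simp add: g_def)
  qed
  have all: "norm (x + s *\<^sub>R y) = norm (x - s *\<^sub>R y)" for s
    using pos[of s] pos[of "- s"] by (cases "y = 0"; cases s "0::real" rule: linorder_cases) auto
  show ?thesis
  proof (cases "a = 0")
    case False
    then have "a *\<^sub>R x + b *\<^sub>R y = a *\<^sub>R (x + (b / a) *\<^sub>R y)"
      "a *\<^sub>R x - b *\<^sub>R y = a *\<^sub>R (x - (b / a) *\<^sub>R y)"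
      by (simp_all add: scaleR_add_right scaleR_diff_right)
    then show ?thesis using all by simp
  qed simp
qed

section \<open>Quadratic forms of maximal determinant below the squared norm\<close>

text \<open>The triple holds the entries of the symmetric matrix with rows \<open>(A, B)\<close> and
  \<open>(B, C)\<close>; as a point of a product of real lines it lends itself to compactness
  arguments.\<close>

definition quad_form :: "real \<times> real \<times> real \<Rightarrow> real \<Rightarrow> real \<Rightarrow> real" where
  "quad_form = (\<lambda>(A, B, C) a b. A * a\<^sup>2 + 2 * B * a * b + C * b\<^sup>2)"

definition quad_det :: "real \<times> real \<times> real \<Rightarrow> real" where
  "quad_det = (\<lambda>(A, B, C). A * C - B\<^sup>2)"

definition forms_below :: "'a::real_normed_vector \<Rightarrow> 'a \<Rightarrow> (real \<times> real \<times> real) set" where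
  "forms_below e f = {Q. 0 \<le> fst Q \<and> 0 \<le> snd (snd Q) \<and> 0 \<le> quad_det Q \<and>
     (\<forall>a b. quad_form Q a b \<le> (norm (a *\<^sub>R e + b *\<^sub>R f))\<^sup>2)}"

lemma quad_form_altdef:
  "quad_form Q a b = fst Q * a\<^sup>2 + 2 * fst (snd Q) * a * b + snd (snd Q) * b\<^sup>2"
  "quad_det Q = fst Q * snd (snd Q) - (fst (snd Q))\<^sup>2"
  by (simp_all add: quad_form_def quad_det_def split: prod.split)

lemma continuous_on_quad_det: "continuous_on S quad_det"
  by (simp add: quad_form_altdef[abs_def] continuous_intros)

text \<open>Evaluation at \<open>e\<close> and \<open>f\<close> bounds the diagonal entries, and the
  nonnegative determinant then bounds the mixed one.\<close>

lemma compact_forms_below: "compact (forms_below e f)"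
proof -
  have "closed (forms_below e f)"
    unfolding forms_below_def quad_form_altdef
    by (intro closed_Collect_conj closed_Collect_all closed_Collect_le continuous_intros)
  moreover have "forms_below e f \<subseteq>
      {0..(norm e)\<^sup>2} \<times> {-(norm e * norm f)..norm e * norm f} \<times> {0..(norm f)\<^sup>2}"
  proof
    fix Q assume Q: "Q \<in> forms_below e f"
    then have q: "quad_form Q a b \<le> (norm (a *\<^sub>R e + b *\<^sub>R f))\<^sup>2" for a b
      by (simp add: forms_below_def)
    have 1: "0 \<le> fst Q" "0 \<le> snd (snd Q)" "fst Q \<le> (norm e)\<^sup>2" "snd (snd Q) \<le> (norm f)\<^sup>2"
      using Q q[of 1 0] q[of 0 1] by (simp_all add: forms_below_def quad_form_altdef)
    have "(fst (snd Q))\<^sup>2 \<le> fst Q * snd (snd Q)"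
      using Q by (simp add: forms_below_def quad_form_altdef)
    also have "\<dots> \<le> (norm e)\<^sup>2 * (norm f)\<^sup>2" using 1 by (intro mult_mono) auto
    finally have "(fst (snd Q))\<^sup>2 \<le> (norm e * norm f)\<^sup>2" by (simp add: power_mult_distrib)
    then have "\<bar>fst (snd Q)\<bar> \<le> norm e * norm f"
      by (simp add: abs_le_square_iff[symmetric] abs_mult)
    then show "Q \<in> {0..(norm e)\<^sup>2} \<times> {-(norm e * norm f)..norm e * norm f} \<times> {0..(norm f)\<^sup>2}"
      using 1 by (cases Q) auto
  qed
  ultimately show ?thesis
    by (metis compact_Icc compact_Times compact_Int_closed inf.absorb_iff2)
qed

text \<open>Averaging \<open>Q\<close> with its image under the reflection that fixes \<open>x\<close> and negates \<open>y\<close> kills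
  the mixed term with respect to \<open>x, y\<close>, which strictly increases the determinant unless the
  mixed term was zero already.\<close>

lemma maximal_form_conjugate:
  fixes e f :: "'a::real_normed_vector"
  assumes Q: "(A, B, C) \<in> forms_below e f"
    and max: "\<And>R. R \<in> forms_below e f \<Longrightarrow> quad_det R \<le> quad_det (A, B, C)"
    and refl: "\<And>a b. norm (a *\<^sub>R (x1 *\<^sub>R e + x2 *\<^sub>R f) + b *\<^sub>R (y1 *\<^sub>R e + y2 *\<^sub>R f))
                  = norm (a *\<^sub>R (x1 *\<^sub>R e + x2 *\<^sub>R f) - b *\<^sub>R (y1 *\<^sub>R e + y2 *\<^sub>R f))"
    and \<Delta>: "x1 * y2 - x2 * y1 \<noteq> 0"
  shows "A * x1 * y1 + B * (x1 * y2 + x2 * y1) + C * x2 * y2 = 0"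
proof -
  define \<Delta> where "\<Delta> = x1 * y2 - x2 * y1"
  define q where "q = quad_form (A, B, C)"
  define m where "m = A * x1 * y1 + B * (x1 * y2 + x2 * y1) + C * x2 * y2"
  have \<Delta>0: "\<Delta> \<noteq> 0" using \<Delta> by (simp add: \<Delta>_def)
  have AC: "A \<ge> 0" "C \<ge> 0" "A * C - B\<^sup>2 \<ge> 0"
    using Q by (simp_all add: forms_below_def quad_form_altdef)
  have qle: "q a b \<le> (norm (a *\<^sub>R e + b *\<^sub>R f))\<^sup>2" for a b
    using Q by (simp add: forms_below_def q_def)
  have qdef: "q a b = A * a\<^sup>2 + 2 * B * a * b + C * b\<^sup>2" for a b
    by (simp add: q_def quad_form_def)
  have q0: "q a b \<ge> 0" for a b
  proof (cases "A = 0")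
    case True
    then have "B = 0" using AC by simp
    then show ?thesis using True AC by (simp add: qdef)
  next
    case False
    have "A * q a b = (A * a + B * b)\<^sup>2 + (A * C - B\<^sup>2) * b\<^sup>2"
      by (simp add: qdef power2_eq_square algebra_simps)
    also have "\<dots> \<ge> 0" using AC by simp
    finally show ?thesis using False AC(1) by (simp add: zero_le_mult_iff)
  qed
  define X Y where "X = q x1 x2 / \<Delta>\<^sup>2" and "Y = q y1 y2 / \<Delta>\<^sup>2"
  have XY0: "X \<ge> 0" "Y \<ge> 0" using q0 by (simp_all add: X_def Y_def)
  \<comment> \<open>\<open>R\<close> is the averaged form: with \<alpha>, \<beta> the coordinates
    with respect to \<open>x\<close>, \<open>y\<close> given by Cramer's rule, it equals
    \<open>\<alpha>\<^sup>2 * q x1 x2 + \<beta>\<^sup>2 * q y1 y2\<close>.\<close>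
  define R where "R = (y2\<^sup>2 * X + x2\<^sup>2 * Y, - (y1 * y2 * X + x1 * x2 * Y), y1\<^sup>2 * X + x1\<^sup>2 * Y)"
  have Rdet: "quad_det R = X * Y * \<Delta>\<^sup>2"
    by (simp add: R_def quad_det_def \<Delta>_def power2_eq_square algebra_simps)
  have Rle: "quad_form R a b \<le> (norm (a *\<^sub>R e + b *\<^sub>R f))\<^sup>2" for a b
  proof -
    define \<alpha> \<beta> where "\<alpha> = (a * y2 - b * y1) / \<Delta>" and "\<beta> = (x1 * b - x2 * a) / \<Delta>"
    have "a * \<Delta> = (a * y2 - b * y1) * x1 + (x1 * b - x2 * a) * y1"
      "b * \<Delta> = (a * y2 - b * y1) * x2 + (x1 * b - x2 * a) * y2"
      by (simp_all add: \<Delta>_def algebra_simps)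
    moreover have "\<alpha> * s + \<beta> * t = ((a * y2 - b * y1) * s + (x1 * b - x2 * a) * t) / \<Delta>" for s t
      by (simp add: \<alpha>_def \<beta>_def add_divide_distrib)
    ultimately have "(\<alpha> * x1 + \<beta> * y1) * \<Delta> = a * \<Delta>" "(\<alpha> * x2 + \<beta> * y2) * \<Delta> = b * \<Delta>"
      using \<Delta>0 by simp_all
    then have ab: "a = \<alpha> * x1 + \<beta> * y1" "b = \<alpha> * x2 + \<beta> * y2"
      using \<Delta>0 by simp_all
    define a' b' where "a' = \<alpha> * x1 - \<beta> * y1" and "b' = \<alpha> * x2 - \<beta> * y2"
    have n: "norm (a' *\<^sub>R e + b' *\<^sub>R f) = norm (a *\<^sub>R e + b *\<^sub>R f)"
      using refl[of \<alpha> \<beta>] by (simp add: ab a'_def b'_def algebra_simps)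
    have "quad_form R a b = X * (a * y2 - b * y1)\<^sup>2 + Y * (x1 * b - x2 * a)\<^sup>2"
      by (simp add: R_def quad_form_def power2_eq_square algebra_simps)
    also have "\<dots> = \<alpha>\<^sup>2 * q x1 x2 + \<beta>\<^sup>2 * q y1 y2"
      by (simp add: X_def Y_def \<alpha>_def \<beta>_def power_divide mult.commute)
    also have "\<dots> = (q a b + q a' b') / 2"
      by (simp add: qdef ab a'_def b'_def power2_eq_square algebra_simps)
    also have "\<dots> \<le> (norm (a *\<^sub>R e + b *\<^sub>R f))\<^sup>2"
      using qle[of a b] qle[of a' b'] n by simp
    finally show ?thesis .
  qed
  have "R \<in> forms_below e f"
    using Rle Rdet XY0 by (simp add: forms_below_def) (simp add: R_def)
  then have "X * Y * \<Delta>\<^sup>2 \<le> A * C - B\<^sup>2"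
    using max[of R] unfolding Rdet by (simp add: quad_det_def)
  then have "X * Y * \<Delta>\<^sup>2 * \<Delta>\<^sup>2 \<le> (A * C - B\<^sup>2) * \<Delta>\<^sup>2"
    by (intro mult_right_mono) simp_all
  moreover have "q x1 x2 = X * \<Delta>\<^sup>2" "q y1 y2 = Y * \<Delta>\<^sup>2"
    using \<Delta>0 by (simp_all add: X_def Y_def)
  ultimately have "q x1 x2 * q y1 y2 \<le> (A * C - B\<^sup>2) * \<Delta>\<^sup>2"
    by (simp add: mult_ac)
  \<comment> \<open>Both sides are the Gram determinant of \<open>q\<close> at \<open>x\<close> and
    \<open>y\<close>, with \<open>m\<close> the value of the polar form there.\<close>
  moreover have "q x1 x2 * q y1 y2 - m\<^sup>2 = (A * C - B\<^sup>2) * \<Delta>\<^sup>2"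
    by (simp add: qdef m_def \<Delta>_def power2_eq_square algebra_simps)
  ultimately have "m\<^sup>2 \<le> 0" by linarith
  then show ?thesis by (simp add: m_def)
qed

section \<open>Bases and coordinates of the plane\<close>

lemma dim_2_basis:
  assumes "dim (UNIV :: 'a::real_vector set) = 2"
  obtains a b :: "'a::real_vector" where "\<And>s t. s *\<^sub>R a + t *\<^sub>R b = 0 \<Longrightarrow> s = 0 \<and> t = 0"
    "\<And>z. \<exists>s t. z = s *\<^sub>R a + t *\<^sub>R b"
proof -
  obtain B :: "'a set" where B: "independent B" "UNIV \<subseteq> span B" "card B = 2"
    using basis_exists[of "UNIV :: 'a set"] assms by metis
  obtain a b where ab: "B = {a, b}" "a \<noteq> b" using B(3) by (auto simp: card_2_iff)
  show ?thesis
  proof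
    show "s = 0 \<and> t = 0" if "s *\<^sub>R a + t *\<^sub>R b = 0" for s t
    proof -
      have "\<forall>v\<in>{a, b}. (if v = a then s else t) = 0"
        using B(1) that ab independentD[of B "{a, b}" "\<lambda>v. if v = a then s else t"] by auto
      then show ?thesis using ab by auto
    qed
    show "\<exists>s t. z = s *\<^sub>R a + t *\<^sub>R b" for z
    proof -
      have "z \<in> span {a, b}" using B(2) ab by auto
      then obtain s t where "z - s *\<^sub>R a - t *\<^sub>R b = 0"
        by (auto simp: span_insert span_empty)
      then have "z = s *\<^sub>R a + t *\<^sub>R b" by (simp add: algebra_simps)
      then show ?thesis by blast
    qed
  qed
qed

text \<open>Rescaling makes the two vectors of a basis equally long. The basis is given as their sum
  and difference because these will be Birkhoff orthogonal to each other in both orders.\<close>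

lemma equal_norm_basis:
  assumes "dim (UNIV :: 'a::real_normed_vector set) = 2"
  obtains u v :: "'a::real_normed_vector" where "norm u = norm v" "u + v \<noteq> 0" "u - v \<noteq> 0"
    "\<And>z. \<exists>s t. z = s *\<^sub>R (u + v) + t *\<^sub>R (u - v)"
proof -
  obtain a b :: 'a where ind: "\<And>s t. s *\<^sub>R a + t *\<^sub>R b = 0 \<Longrightarrow> s = 0 \<and> t = 0"
    and span: "\<And>z. \<exists>s t. z = s *\<^sub>R a + t *\<^sub>R b"
    using dim_2_basis[OF assms] by metis
  have "a \<noteq> 0" "b \<noteq> 0" using ind[of 1 0] ind[of 0 1] by auto
  define u v where "u = (norm b) *\<^sub>R a" and "v = (norm a) *\<^sub>R b"
  show ?thesis
  proof
    show "norm u = norm v" by (simp add: u_def v_def)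
    show "u + v \<noteq> 0" using ind[of "norm b" "norm a"] \<open>a \<noteq> 0\<close> by (auto simp: u_def v_def)
    show "u - v \<noteq> 0" using ind[of "norm b" "- norm a"] \<open>a \<noteq> 0\<close> by (auto simp: u_def v_def)
    fix z
    obtain s t where z: "z = s *\<^sub>R a + t *\<^sub>R b" using span by blast
    define s' t' where "s' = s / norm b" and "t' = t / norm a"
    have z: "z = s' *\<^sub>R u + t' *\<^sub>R v"
      using \<open>a \<noteq> 0\<close> \<open>b \<noteq> 0\<close> by (simp add: z u_def v_def s'_def t'_def)
    have "((s' + t') / 2) *\<^sub>R (u + v) + ((s' - t') / 2) *\<^sub>R (u - v)
        = ((s' + t') / 2 + (s' - t') / 2) *\<^sub>R u + ((s' + t') / 2 - (s' - t') / 2) *\<^sub>R v"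
      by (simp only: scaleR_add_left scaleR_diff_left scaleR_add_right scaleR_diff_right)
        (simp add: algebra_simps)
    also have "\<dots> = z" by (simp add: z field_simps)
    finally show "\<exists>s t. z = s *\<^sub>R (u + v) + t *\<^sub>R (u - v)" by metis
  qed
qed

text \<open>The inner product is the polar form of the quadratic form, in coordinates read off by an
  inverse \<open>g\<close> of \<Phi>; its positivity comes from the norm.\<close>

lemma induced_by_inner_product_if_quad_form:
  fixes e f :: "'a::real_normed_vector"
  assumes ind: "\<And>s t. s *\<^sub>R e + t *\<^sub>R f = 0 \<Longrightarrow> s = 0 \<and> t = 0"
    and span: "\<And>z. \<exists>s t. z = s *\<^sub>R e + t *\<^sub>R f"
    and Q: "\<And>s t. (norm (s *\<^sub>R e + t *\<^sub>R f))\<^sup>2 = quad_form (A, B, C) s t"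
  shows "induced_by_inner_product (norm :: 'a \<Rightarrow> real)"
proof -
  define \<Phi> :: "real \<times> real \<Rightarrow> 'a" where "\<Phi> p = fst p *\<^sub>R e + snd p *\<^sub>R f" for p
  have lin: "linear \<Phi>"
    by (rule linearI) (simp_all add: \<Phi>_def algebra_simps)
  have "inj \<Phi>"
    unfolding linear_injective_0[OF lin] using ind by (auto simp: \<Phi>_def prod_eq_iff)
  then obtain g where g: "linear g" "g \<circ> \<Phi> = id"
    using linear_injective_left_inverse[OF lin] by blast
  have coord: "fst (g z) *\<^sub>R e + snd (g z) *\<^sub>R f = z" for z
  proof -
    obtain s t where z: "z = \<Phi> (s, t)" using span[of z] by (auto simp: \<Phi>_def)
    have "g z = (s, t)" using g(2) by (simp add: z fun_eq_iff)
    then show ?thesis by (simp add: z \<Phi>_def)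
  qed
  define ip where "ip z w = A * fst (g z) * fst (g w)
    + B * (fst (g z) * snd (g w) + snd (g z) * fst (g w)) + C * snd (g z) * snd (g w)" for z w
  have n: "ip z z = (norm z)\<^sup>2" for z
    using Q[of "fst (g z)" "snd (g z)"]
    by (simp add: coord ip_def quad_form_def power2_eq_square)
  have "bilinear ip"
    unfolding bilinear_def
    by (auto intro!: linearI simp: ip_def linear_add[OF g(1)] linear_scale[OF g(1)] algebra_simps)
  then have "inner_product_on_type ip"
    unfolding inner_product_on_type_def n by (auto simp: ip_def)
  then show ?thesis
    unfolding induced_by_inner_product_def by (intro exI[of _ ip]) (simp add: n)
qed

section \<open>The maximal form as a multiple of the squared norm\<close>

lemma induced_by_inner_product_if_sum_birkhoff_diff:
  assumes dim: "dim (UNIV :: 'a::real_normed_vector set) = 2"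
    and H: "\<And>u v::'a. norm u = norm v \<Longrightarrow> (u + v) \<bottom>\<^sub>B (u - v)"
  shows "induced_by_inner_product (norm :: 'a \<Rightarrow> real)"
proof -
  obtain u v :: 'a where uv: "norm u = norm v" "u + v \<noteq> 0" "u - v \<noteq> 0"
    and "\<And>z. \<exists>s t. z = s *\<^sub>R (u + v) + t *\<^sub>R (u - v)"
    using equal_norm_basis[OF dim] by metis
  define e f where "e = u + v" and "f = u - v"
  have e0: "e \<noteq> 0" and f0: "f \<noteq> 0" using uv by (simp_all add: e_def f_def)
  have span: "\<exists>s t. z = s *\<^sub>R e + t *\<^sub>R f" for z
    unfolding e_def f_def by fact
  have "e \<bottom>\<^sub>B f" "f \<bottom>\<^sub>B e" using H[of u v] H[of u "- v"] uv by (simp_all add: e_def f_def)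
  then have ge: "\<bar>s\<bar> * norm e \<le> norm (s *\<^sub>R e + t *\<^sub>R f)" "\<bar>t\<bar> * norm f \<le> norm (s *\<^sub>R e + t *\<^sub>R f)" for s t
    using birkhoff_norm_ge[of e f s t] birkhoff_norm_ge[of f e t s]
    by (simp_all add: add.commute[of "s *\<^sub>R e"])
  have ind: "s = 0 \<and> t = 0" if "s *\<^sub>R e + t *\<^sub>R f = 0" for s t
    using ge(1)[of s t] ge(2)[of t s] that e0 f0 by (simp add: mult_le_0_iff)
  \<comment> \<open>Each coordinate term is bounded by the squared norm, hence so is their mean
    \<open>Q0\<close>. This form shows that the maximal determinant is positive.\<close>
  define Q0 where "Q0 = ((norm e)\<^sup>2 / 2, 0::real, (norm f)\<^sup>2 / 2)"
  have "quad_form Q0 s t \<le> (norm (s *\<^sub>R e + t *\<^sub>R f))\<^sup>2" for s t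
  proof -
    have "(\<bar>s\<bar> * norm e)\<^sup>2 \<le> (norm (s *\<^sub>R e + t *\<^sub>R f))\<^sup>2" "(\<bar>t\<bar> * norm f)\<^sup>2 \<le> (norm (s *\<^sub>R e + t *\<^sub>R f))\<^sup>2"
      using ge(1)[of s t] ge(2)[of t s] by (intro power_mono; simp)+
    then show ?thesis by (simp add: Q0_def quad_form_def power_mult_distrib field_simps)
  qed
  then have Q0: "Q0 \<in> forms_below e f" "quad_det Q0 > 0"
    using e0 f0 by (auto simp: forms_below_def Q0_def quad_det_def)
  then obtain Q where "Q \<in> forms_below e f"
    and "\<And>R. R \<in> forms_below e f \<Longrightarrow> quad_det R \<le> quad_det Q"
    using continuous_attains_sup[OF compact_forms_below _ continuous_on_quad_det, of e f] by blast
  moreover obtain A B C where "Q = (A, B, C)" by (cases Q)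
  ultimately have Q: "(A, B, C) \<in> forms_below e f"
    and max: "\<And>R. R \<in> forms_below e f \<Longrightarrow> quad_det R \<le> quad_det (A, B, C)" by auto
  have "A * C > B\<^sup>2" using max[OF Q0(1)] Q0(2) by (simp add: quad_det_def)
  then have "A \<noteq> 0" by (auto simp: not_less)
  then have A: "A > 0" using Q by (simp add: forms_below_def)
  define q where "q = quad_form (A, B, C)"
  have qdef: "q a b = A * a\<^sup>2 + 2 * B * a * b + C * b\<^sup>2" for a b
    by (simp add: q_def quad_form_def)
  have const: "q u1 u2 = q v1 v2"
    if n: "norm (u1 *\<^sub>R e + u2 *\<^sub>R f) = norm (v1 *\<^sub>R e + v2 *\<^sub>R f)" for u1 u2 v1 v2
  proof -
    \<comment> \<open>The reflection fixing the sum \<open>x\<close> and negating the difference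
      \<open>y\<close> swaps the two given vectors, and the polar form at \<open>x\<close>,
      \<open>y\<close> is the difference of their values under \<open>q\<close>.\<close>
    define x1 x2 y1 y2 where "x1 = u1 + v1" and "x2 = u2 + v2" and "y1 = u1 - v1" and "y2 = u2 - v2"
    define x y where "x = x1 *\<^sub>R e + x2 *\<^sub>R f" and "y = y1 *\<^sub>R e + y2 *\<^sub>R f"
    have "x \<bottom>\<^sub>B y"
      using H[OF n] by (simp add: x_def y_def x1_def x2_def y1_def y2_def algebra_simps)
    have diff: "q u1 u2 - q v1 v2 = A * x1 * y1 + B * (x1 * y2 + x2 * y1) + C * x2 * y2"
      by (simp add: qdef x1_def x2_def y1_def y2_def power2_eq_square algebra_simps)
    show ?thesis
    proof (cases "x1 * y2 - x2 * y1 = 0")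
      case False
      have "A * x1 * y1 + B * (x1 * y2 + x2 * y1) + C * x2 * y2 = 0"
        using birkhoff_imp_reflection[OF H \<open>x \<bottom>\<^sub>B y\<close>]
        by (intro maximal_form_conjugate[OF Q max _ False]) (simp_all add: x_def y_def)
      then show ?thesis using diff by simp
    next
      case True
      \<comment> \<open>Here \<open>x\<close> and \<open>y\<close> are linearly dependent; being
        Birkhoff orthogonal, one of them must be zero, so the two vectors are equal or
        opposite.\<close>
      have "y1 *\<^sub>R x + (- x1) *\<^sub>R y = (x2 * y1 - x1 * y2) *\<^sub>R f"
        "y2 *\<^sub>R x + (- x2) *\<^sub>R y = (x1 * y2 - x2 * y1) *\<^sub>R e"
        by (simp_all add: x_def y_def algebra_simps)
      then have "y1 *\<^sub>R x + (- x1) *\<^sub>R y = 0" "y2 *\<^sub>R x + (- x2) *\<^sub>R y = 0" using True by simp_all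
      then have "\<bar>y1\<bar> * norm x \<le> 0" "\<bar>y2\<bar> * norm x \<le> 0"
        using birkhoff_norm_ge[OF \<open>x \<bottom>\<^sub>B y\<close>] by (metis norm_zero)+
      then have "x = 0 \<or> y1 = 0 \<and> y2 = 0" by (auto simp: mult_le_0_iff)
      then have "x1 = 0 \<and> x2 = 0 \<or> y1 = 0 \<and> y2 = 0" using ind by (auto simp: x_def)
      then show ?thesis using diff by auto
    qed
  qed
  \<comment> \<open>\<open>k\<close> is the constant value of \<open>q\<close> on unit vectors,
    computed from \<open>e\<close>, where \<open>q\<close> takes the value \<open>A\<close>.\<close>
  define k where "k = A / (norm e)\<^sup>2"
  have k: "k > 0" using A e0 by (simp add: k_def)
  have norm_q: "(norm (s *\<^sub>R e + t *\<^sub>R f))\<^sup>2 = q s t / k" for s t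
  proof -
    define c where "c = norm (s *\<^sub>R e + t *\<^sub>R f) / norm e"
    have "norm (s *\<^sub>R e + t *\<^sub>R f) = norm (c *\<^sub>R e + 0 *\<^sub>R f)"
      using e0 by (simp add: c_def)
    then have "q s t = q c 0" by (rule const)
    also have "\<dots> = k * (norm (s *\<^sub>R e + t *\<^sub>R f))\<^sup>2"
      by (simp add: qdef c_def k_def power_divide)
    finally show ?thesis using k by simp
  qed
  have "(norm (s *\<^sub>R e + t *\<^sub>R f))\<^sup>2 = quad_form (A / k, B / k, C / k) s t" for s t
    by (simp add: norm_q qdef quad_form_def add_divide_distrib)
  then show ?thesis by (intro induced_by_inner_product_if_quad_form[OF ind span])
qed

theorem theorem3p6:
  assumes "dim (UNIV :: 'a::real_normed_vector set) = 2"
  shows "induced_by_inner_product (norm :: 'a \<Rightarrow> real) \<longleftrightarrow>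
    (\<forall>p :: nat \<Rightarrow> 'a. C_orthocentric_system p \<longrightarrow>
       (\<forall>i j k l. {i, j, k, l} = {1, 2, 3, 4} \<longrightarrow> (p i - p j) \<bottom>\<^sub>B (p k - p l)))"
    (is "?L \<longleftrightarrow> ?R")
proof
  assume ?L
  then obtain ip :: "'a \<Rightarrow> 'a \<Rightarrow> real"
    where ip: "inner_product_on_type ip" and N: "\<And>x. norm x = sqrt (ip x x)"
    by (auto simp: induced_by_inner_product_def)
  show ?R
    using inner_product_orthocentric[OF ip N] inner_product_zero_imp_birkhoff[OF ip N] by blast
next
  assume R: ?R
  show ?L
    using induced_by_inner_product_if_sum_birkhoff_diff[OF assms]
      orthocentric_imp_sum_birkhoff_diff[OF R] by blast
qed

end
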